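(* Let $f_{\min}\in\mathbb{R}$ and define $\mathrm{EI}:\mathbb{R}\times[0,\infty)\to\mathbb{R}$ by $$\mathrm{EI}(\mu,\sigma)=\begin{cases}(f_{\min}-\mu)\,\Phi\!\left(\frac{f_{\min}-\mu}{\sigma}\right)+\sigma\,\phi\!\left(\frac{f_{\min}-\mu}{\sigma}\right), & \sigma>0,\\ f_{\min}-\mu, & \sigma=0,\ \mu<f_{\min},\\ 0, & \sigma=0,\ \mu\ge f_{\min}.\end{cases}$$ Then $\mathrm{EI}$ is convex (jointly in $(\mu,\sigma)$) on $\mathbb{R}\times[0,\infty)$.
   Context: $\phi(x)=\frac{1}{\sqrt{2\pi}}\exp(-x^2/2)$ is the standard Gaussian probability density function and $\Phi(x)=\int_{-\infty}^x\phi(t)\,dt$ is the standard Gaussian cumulative distribution function. $\mathrm{EI}$ is the expected improvement acquisition function. *)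

theory Defs
  imports "HOL-Probability.Probability"
begin

definition std_normal_cdf :: "real \<Rightarrow> real" where
  "std_normal_cdf x = (LINT t:{..x}|lborel. std_normal_density t)"

(* The domain is \<sigma> \<ge> 0; for \<sigma> < 0 the value is junk (that of \<sigma> = 0). *)
definition EI :: "real \<Rightarrow> real \<Rightarrow> real \<Rightarrow> real" where
  "EI f_min \<mu> \<sigma> =
     (if \<sigma> > 0 then (f_min - \<mu>) * std_normal_cdf ((f_min - \<mu>) / \<sigma>)
                   + \<sigma> * std_normal_density ((f_min - \<mu>) / \<sigma>)
      else if \<mu> < f_min then f_min - \<mu>
      else 0)"

end

theory Submission
  imports Defs
begin

text \<open>
  Write \<open>a = f_min - \<mu>\<close>. For fixed \<open>\<sigma> > 0\<close> the function \<open>c \<mapsto> a \<Phi>(c) + \<sigma> \<phi>(c)\<close> has derivative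
  \<open>(a - \<sigma> c) \<phi>(c)\<close>, so its maximum is attained at \<open>c = a / \<sigma>\<close> and equals \<open>EI(\<mu>, \<sigma>)\<close>. Hence
  \<open>EI\<close> dominates all these functions, which are affine in \<open>(\<mu>, \<sigma>)\<close>, and touches one of them at
  every point with \<open>\<sigma> > 0\<close>. On the boundary \<open>\<sigma> = 0\<close> it is \<open>max 0 a\<close>, which still dominates them.
\<close>

lemma set_integrable_std_normal_density:
  "A \<in> sets borel \<Longrightarrow> set_integrable lborel A std_normal_density"
  using integrable_mult_indicator[of A lborel std_normal_density]
  by (simp add: set_integrable_def)

lemma std_normal_cdf_nonneg: "0 \<le> std_normal_cdf x"
  unfolding std_normal_cdf_def set_lebesgue_integral_def
  by (rule integral_nonneg_AE) (auto simp: indicator_def)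

lemma std_normal_cdf_le_one: "std_normal_cdf x \<le> 1"
proof -
  have "std_normal_cdf x \<le> integral\<^sup>L lborel std_normal_density"
    unfolding std_normal_cdf_def set_lebesgue_integral_def
    by (rule integral_mono)
       (use set_integrable_std_normal_density[of "{..x}"] in
         \<open>auto simp: set_integrable_def indicator_def\<close>)
  then show ?thesis by simp
qed

text \<open>Isolates the dependence on \<open>x\<close> in an integral over a compact interval,
  where the fundamental theorem of calculus applies.\<close>

lemma std_normal_cdf_split:
  assumes "m \<le> x"
  shows "std_normal_cdf x = std_normal_cdf m + integral {m..x} std_normal_density"
proof -
  have eq: "{..x} = {..m} \<union> {m<..x}" using assms by auto
  have "std_normal_cdf x = std_normal_cdf m + (LINT t:{m<..x}|lborel. std_normal_density t)"
    unfolding std_normal_cdf_def eq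
    by (rule set_integral_Un) (auto intro!: set_integrable_std_normal_density)
  \<comment> \<open>Adding the endpoint \<open>m\<close> changes the integrand only on a null
    set.\<close>
  also have "(LINT t:{m<..x}|lborel. std_normal_density t)
      = (LINT t:{m..x}|lborel. std_normal_density t)"
    unfolding set_lebesgue_integral_def
    by (rule integral_cong_AE)
       (use AE_lborel_singleton[of m] in \<open>auto simp: indicator_def elim!: eventually_mono\<close>)
  also have "\<dots> = integral {m..x} std_normal_density"
    by (rule set_borel_integral_eq_integral) (rule set_integrable_std_normal_density, simp)
  finally show ?thesis .
qed

lemma has_real_derivative_std_normal_density:
  "(std_normal_density has_real_derivative - x * std_normal_density x) (at x)"
proof -
  \<comment> \<open>The arbitrary factor \<open>k\<close> stands for the normalising constant
    \<open>1 / sqrt (2 * pi)\<close>.\<close>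
  have "((\<lambda>x. k * exp (- x\<^sup>2 / 2)) has_real_derivative - x * (k * exp (- x\<^sup>2 / 2))) (at x)" for k :: real
    by (auto intro!: derivative_eq_intros)
  then show ?thesis unfolding std_normal_density_def .
qed

lemma has_real_derivative_std_normal_cdf:
  "(std_normal_cdf has_real_derivative std_normal_density x) (at x)"
proof -
  \<comment> \<open>The radius 1 is arbitrary: \<open>x\<close> only has to be interior, so that the
    one-interval derivative becomes a full one.\<close>
  have "continuous_on {x - 1..x + 1} std_normal_density"
    using has_real_derivative_std_normal_density
    by (intro DERIV_continuous_on) (blast intro: DERIV_subset)
  then have "((\<lambda>u. integral {x - 1..u} std_normal_density) has_real_derivative std_normal_density x)
      (at x within {x - 1..x + 1})"
    by (rule integral_has_real_derivative) simp
  then have "((\<lambda>u. integral {x - 1..u} std_normal_density) has_real_derivative std_normal_density x)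
      (at x)"
    by (simp add: at_within_Icc_at)
  then have "((\<lambda>u. std_normal_cdf (x - 1) + integral {x - 1..u} std_normal_density)
      has_real_derivative std_normal_density x) (at x)"
    by (auto intro!: derivative_eq_intros)
  \<comment> \<open>The splitting needs \<open>u\<close> \<ge> \<open>x - 1\<close>; agreement on
    the open neighbourhood \<open>{x - 1<..}\<close> of \<open>x\<close> suffices for
    derivatives.\<close>
  then show ?thesis
    by (rule DERIV_cong_ev[THEN iffD1, OF refl _ refl, rotated])
       (auto simp: eventually_nhds intro!: exI[of _ "{x - 1<..}"] std_normal_cdf_split[symmetric])
qed

text \<open>The case \<sigma> = 1. The derivative in \<open>c\<close> is nonnegative left of
  \<open>d\<close> and nonpositive right of it, so \<open>d\<close> is a global maximiser.\<close>

lemma gaussian_combination_le_max: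
  "d * std_normal_cdf c + std_normal_density c \<le> d * std_normal_cdf d + std_normal_density d"
proof -
  define h where "h c = d * std_normal_cdf c + std_normal_density c" for c
  have deriv: "(h has_real_derivative (d - x) * std_normal_density x) (at x)" for x
    unfolding h_def
    by (auto intro!: derivative_eq_intros has_real_derivative_std_normal_cdf
          has_real_derivative_std_normal_density simp: algebra_simps)
  have "h c \<le> h d"
  proof (cases "c \<le> d")
    case True
    then show ?thesis
      by (rule DERIV_nonneg_imp_nondecreasing) (use deriv in \<open>force intro!: mult_nonneg_nonneg\<close>)
  next
    case False
    then have "d \<le> c" by simp
    then show ?thesis
      by (rule DERIV_nonpos_imp_nonincreasing) (use deriv in \<open>force intro!: mult_nonpos_nonneg\<close>)
  qed
  then show ?thesis by (simp add: h_def)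
qed

lemma affine_minorant_le_EI:
  assumes "\<sigma> \<ge> 0"
  shows "(f_min - \<mu>) * std_normal_cdf c + \<sigma> * std_normal_density c \<le> EI f_min \<mu> \<sigma>"
proof (cases "\<sigma> > 0")
  case True
  define d where "d = (f_min - \<mu>) / \<sigma>"
  \<comment> \<open>Both sides are homogeneous of degree 1 in
    \<open>(f_min - \<mu>, \<sigma>)\<close>, so scaling reduces to \<sigma> = 1.\<close>
  have a: "f_min - \<mu> = \<sigma> * d" using True by (simp add: d_def)
  have "\<sigma> * (d * std_normal_cdf c + std_normal_density c)
      \<le> \<sigma> * (d * std_normal_cdf d + std_normal_density d)"
    using True by (intro mult_left_mono gaussian_combination_le_max) auto
  then show ?thesis
    using True by (simp add: EI_def a algebra_simps)
next
  \<comment> \<open>Here \<sigma> = 0, and a number times a weight in [0, 1] is at most its positive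
    part.\<close>
  case False
  then show ?thesis
    using assms std_normal_cdf_nonneg[of c] std_normal_cdf_le_one[of c]
    by (auto simp: EI_def mult_le_0_iff intro!: mult_left_le)
qed

theorem mainTheorem2:
  fixes f_min :: real
  shows "convex_on (UNIV \<times> {0..}) (\<lambda>(\<mu>, \<sigma>). EI f_min \<mu> \<sigma>)"
proof (rule convex_onI)
  show "convex (UNIV \<times> {0..} :: (real \<times> real) set)"
    by (intro convex_Times) auto
next
  fix t :: real and x y :: "real \<times> real"
  assume t: "0 < t" "t < 1" and xy: "x \<in> UNIV \<times> {0..}" "y \<in> UNIV \<times> {0..}"
  obtain \<mu>1 \<sigma>1 \<mu>2 \<sigma>2 where x: "x = (\<mu>1, \<sigma>1)" and y: "y = (\<mu>2, \<sigma>2)"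
    by (metis surj_pair)
  have s: "\<sigma>1 \<ge> 0" "\<sigma>2 \<ge> 0" using xy x y by auto
  define \<mu> \<sigma> where "\<mu> = (1 - t) * \<mu>1 + t * \<mu>2" and "\<sigma> = (1 - t) * \<sigma>1 + t * \<sigma>2"
  have "EI f_min \<mu> \<sigma> \<le> (1 - t) * EI f_min \<mu>1 \<sigma>1 + t * EI f_min \<mu>2 \<sigma>2"
  proof (cases "\<sigma> > 0")
    case True
    \<comment> \<open>The maximiser at the intermediate point; keeping this one \<open>c\<close> at
      both endpoints gives a supporting affine function.\<close>
    define c where "c = (f_min - \<mu>) / \<sigma>"
    have "EI f_min \<mu> \<sigma> = (f_min - \<mu>) * std_normal_cdf c + \<sigma> * std_normal_density c"
      using True by (simp add: EI_def c_def)
    also have "\<dots> = (1 - t) * ((f_min - \<mu>1) * std_normal_cdf c + \<sigma>1 * std_normal_density c)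
        + t * ((f_min - \<mu>2) * std_normal_cdf c + \<sigma>2 * std_normal_density c)"
      by (simp add: \<mu>_def \<sigma>_def algebra_simps)
    also have "\<dots> \<le> (1 - t) * EI f_min \<mu>1 \<sigma>1 + t * EI f_min \<mu>2 \<sigma>2"
      using t s by (intro add_mono mult_left_mono affine_minorant_le_EI) auto
    finally show ?thesis .
  next
    \<comment> \<open>Both weights are positive, so \<sigma> = 0 forces both endpoints onto the
      boundary, where convexity of the positive part remains.\<close>
    case False
    have nn: "(1 - t) * \<sigma>1 \<ge> 0" "t * \<sigma>2 \<ge> 0" using t s by auto
    then have "(1 - t) * \<sigma>1 = 0" "t * \<sigma>2 = 0" using False unfolding \<sigma>_def by linarith+
    then have "\<sigma>1 = 0" "\<sigma>2 = 0" using t by auto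
    moreover have EI0: "EI f_min m 0 = max 0 (f_min - m)" for m
      by (simp add: EI_def max_def)
    moreover have "f_min - \<mu> = (1 - t) * (f_min - \<mu>1) + t * (f_min - \<mu>2)"
      by (simp add: \<mu>_def algebra_simps)
    moreover have "\<dots> \<le> (1 - t) * max 0 (f_min - \<mu>1) + t * max 0 (f_min - \<mu>2)"
      using t by (intro add_mono mult_left_mono) auto
    moreover have "0 \<le> (1 - t) * max 0 (f_min - \<mu>1) + t * max 0 (f_min - \<mu>2)"
      using t by auto
    ultimately show ?thesis by (simp add: \<sigma>_def)
  qed
  then show "(case (1 - t) *\<^sub>R x + t *\<^sub>R y of (\<mu>, \<sigma>) \<Rightarrow> EI f_min \<mu> \<sigma>)
      \<le> (1 - t) * (case x of (\<mu>, \<sigma>) \<Rightarrow> EI f_min \<mu> \<sigma>) + t * (case y of (\<mu>, \<sigma>) \<Rightarrow> EI f_min \<mu> \<sigma>)"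
    by (simp add: x y \<mu>_def \<sigma>_def)
qed

end
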